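(* Suppose that $0\le \delta_k\le 2$ for all $k=1,\dots,r$, and let $\pi:[r]\to[r]$ be any permutation. Then the degree vector $m^{\pi}\in\mathbb{Z}^r$ given by $$m_k^{\pi}=\Bigl(1-\delta_k+\sum_{j:\,\pi(j)\ge\pi(k)} l_j\Bigr)d_k-l_k,\qquad k=1,\dots,r,$$ is determinantal, i.e. it defines a determinantal (Weyman) complex.
   Context: Let $r\ge 1$ and let $l=(l_1,\dots,l_r)$, $d=(d_1,\dots,d_r)$ be vectors of positive integers; put $n=\sum_{k=1}^r l_k$ and $[r]=\{1,\dots,r\}$. Let $X=\mathbb{P}^{l_1}\times\cdots\times\mathbb{P}^{l_r}$ over an algebraically closed field of characteristic zero. For $a\in\mathbb{Z}^r$, $H^q(X,a)$ denotes the $q$-th cohomology of the sheaf $\mathcal{O}_X(a_1,\dots,a_r)$, and $H^j(\mathbb{P}^{l_k},a_k)$ is the cohomology of $\mathcal{O}(a_k)$ on $\mathbb{P}^{l_k}$. By the Künneth and Bott formulae, $H^q(X,a)=\bigoplus\bigotimes_{k}H^{j_k}(\mathbb{P}^{l_k},a_k)$ (sum over $j_k\in\{0,l_k\}$ with $\sum_k j_k=q$), where $H^0(\mathbb{P}^{l_k},a_k)\ne0\iff a_k\ge0$ and $H^{l_k}(\mathbb{P}^{l_k},a_k)\neq0\iff a_k<-l_k$. For a degree vector $m\in\mathbb{Z}^r$ and $\nu\in\mathbb{Z}$, the $\nu$-th term of the Weyman complex is $K_\nu(m)=\bigoplus_{p=0}^{n+1}H^{p-\nu}(X,m-pd)^{\binom{n+1}{p}}$.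 The vector $m$ (and its Weyman complex) is called determinantal if the complex has just the two terms $K_1(m)\to K_0(m)$, i.e. $K_\nu(m)=0$ for all $\nu\notin\{0,1\}$; by a result of Weyman and Zelevinsky this is equivalent to $K_{-1}(m)=K_2(m)=0$. The defect vector $\delta\in\mathbb{Z}^r$ is $\delta_k=l_k-\lceil l_k/d_k\rceil$. *)

theory Defs
  imports
    "HOL-Algebra.Coset"
    "HOL-Algebra.Product_Groups"
    "HOL-Combinatorics.Permutations"
    "HOL-Computational_Algebra.Polynomial"
    "HOL-Library.FuncSet"
    "HOL-Library.Poly_Mapping"
begin

text \<open>
  Sheaf cohomology of \<open>O(a)\<close> on \<open>X = P^(l 1) \<times> \<dots> \<times> P^(l r)\<close> over the field \<open>'k\<close> is the Cech cohomology
  of the standard affine open cover, with the sections of \<open>O(a)\<close> over an intersection of members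
  of the cover given by the degree \<open>a\<close> part of a localisation of the multigraded coordinate ring.

  All sections live in one ring of Laurent polynomials in variables \<open>x(k,i)\<close> indexed by pairs of
  naturals; an exponent vector is a finitely supported map to \<open>int\<close>. Vectors indexed by
  \<open>{1..r}\<close> are functions on \<open>nat\<close> that are only ever evaluated on \<open>{1..r}\<close>.
\<close>

type_synonym expo = "nat \<times> nat \<Rightarrow>\<^sub>0 int"
type_synonym 'k laurent = "expo \<Rightarrow>\<^sub>0 'k"

text \<open>The homogeneous coordinates of the \<open>k\<close>-th factor are \<open>x(k,0), \<dots>, x(k,l k)\<close>.\<close>

definition coord :: "nat \<Rightarrow> nat \<Rightarrow> 'k::field laurent" where
  "coord k i = Poly_Mapping.single (Poly_Mapping.single (k, i) 1) 1"

definition coord_ring :: "nat \<Rightarrow> (nat \<Rightarrow> nat) \<Rightarrow> 'k::field laurent set" where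
  "coord_ring r l =
     {f. \<forall>e \<in> Poly_Mapping.keys f.
           Poly_Mapping.keys e \<subseteq> (SIGMA k:{1..r}. {0..l k}) \<and>
           (\<forall>v. 0 \<le> Poly_Mapping.lookup e v)}"

definition multihomogeneous ::
    "nat \<Rightarrow> (nat \<Rightarrow> nat) \<Rightarrow> (nat \<Rightarrow> int) \<Rightarrow> 'k::field laurent \<Rightarrow> bool" where
  "multihomogeneous r l a f \<longleftrightarrow>
     (\<forall>e \<in> Poly_Mapping.keys f. \<forall>k \<in> {1..r}. (\<Sum>i=0..l k. Poly_Mapping.lookup e (k, i)) = a k)"

text \<open>
  The standard cover: a chart \<open>c\<close> picks one coordinate from each factor, and
  \<open>U c = {x. \<forall>k. x(k, c k) \<noteq> 0}\<close>.
\<close>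

definition charts :: "nat \<Rightarrow> (nat \<Rightarrow> nat) \<Rightarrow> (nat \<Rightarrow> nat) set" where
  "charts r l = (\<Pi>\<^sub>E k\<in>{1..r}. {0..l k})"

text \<open>
  The intersection of \<open>U c\<close> over \<open>c \<in> S\<close> is the non-vanishing locus of the monomial
  \<open>g = (\<Prod>c\<in>S. \<Prod>k. x(k, c k))\<close>, so the sections of \<open>O(a)\<close> on it are the elements of degree \<open>a\<close> of
  the coordinate ring localised at \<open>g\<close>. As \<open>g\<close> is a unit among Laurent polynomials, that localisation is
  the set of all \<open>f\<close> such that some \<open>g ^ N * f\<close> is a polynomial.
\<close>

definition sections ::
    "nat \<Rightarrow> (nat \<Rightarrow> nat) \<Rightarrow> (nat \<Rightarrow> int) \<Rightarrow> (nat \<Rightarrow> nat) set \<Rightarrow> 'k::field laurent set" where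
  "sections r l a S =
     {f. multihomogeneous r l a f \<and>
         (\<exists>N. (\<Prod>c\<in>S. \<Prod>k=1..r. coord k (c k)) ^ N * f \<in> coord_ring r l)}"

text \<open>
  Cech cochains are indexed by all \<open>(q+1)\<close>-tuples of charts, repetitions allowed. The degree \<open>q\<close> ranges over
  the integers; there are no tuples, hence only the zero cochain, when \<open>q < 0\<close>. In particular the
  empty list is excluded, so the complex is not augmented. Off the tuples, cochains are \<open>0\<close>.
\<close>

definition chart_tuples :: "nat \<Rightarrow> (nat \<Rightarrow> nat) \<Rightarrow> int \<Rightarrow> (nat \<Rightarrow> nat) list set" where
  "chart_tuples r l q = {s. s \<noteq> [] \<and> int (length s) = q + 1 \<and> set s \<subseteq> charts r l}"

type_synonym 'k cochain = "(nat \<Rightarrow> nat) list \<Rightarrow> 'k laurent"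

definition cech_cochains ::
    "nat \<Rightarrow> (nat \<Rightarrow> nat) \<Rightarrow> (nat \<Rightarrow> int) \<Rightarrow> int \<Rightarrow> 'k::field cochain monoid" where
  "cech_cochains r l a q =
     \<lparr>carrier = {f. (\<forall>s \<in> chart_tuples r l q. f s \<in> sections r l a (set s)) \<and>
                    (\<forall>s. s \<notin> chart_tuples r l q \<longrightarrow> f s = 0)},
      monoid.mult = (\<lambda>f g s. f s + g s),
      monoid.one = (\<lambda>s. 0)\<rparr>"

definition cech_diff ::
    "nat \<Rightarrow> (nat \<Rightarrow> nat) \<Rightarrow> int \<Rightarrow> 'k::field cochain \<Rightarrow> 'k cochain" where
  "cech_diff r l q f =
     (\<lambda>s. if s \<in> chart_tuples r l (q + 1)
          then \<Sum>j<length s. (-1) ^ j * f (take j s @ drop (Suc j) s) else 0)"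

text \<open>
  The cohomology \<open>H^q(X, a)\<close> for \<open>q\<close> any integer, as the additive group of cocycles modulo coboundaries.
\<close>

definition cohomology ::
    "nat \<Rightarrow> (nat \<Rightarrow> nat) \<Rightarrow> int \<Rightarrow> (nat \<Rightarrow> int) \<Rightarrow> 'k::field cochain set monoid" where
  "cohomology r l q a =
     (cech_cochains r l a q)
       \<lparr>carrier := kernel (cech_cochains r l a q) (cech_cochains r l a (q + 1)) (cech_diff r l q)\<rparr>
     Mod (cech_diff r l (q - 1) ` carrier (cech_cochains r l a (q - 1)))"

text \<open>
  The index \<open>(p, c)\<close> with \<open>c < (n + 1) choose p\<close> enumerates the copies of the \<open>p\<close>-th summand.
\<close>

definition weyman_term ::
    "nat \<Rightarrow> (nat \<Rightarrow> nat) \<Rightarrow> (nat \<Rightarrow> nat) \<Rightarrow> (nat \<Rightarrow> int) \<Rightarrow> int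
       \<Rightarrow> (nat \<times> nat \<Rightarrow> 'k::field cochain set) monoid" where
  "weyman_term r l d m \<nu> =
     (let n = (\<Sum>k=1..r. l k) in
      sum_group (SIGMA p:{0..n + 1}. {..<(n + 1) choose p})
        (\<lambda>(p, c). cohomology r l (int p - \<nu>) (\<lambda>k. m k - int p * int (d k))))"

text \<open>The type argument carries the ground field.\<close>

definition determinantal ::
    "'k::field itself \<Rightarrow> nat \<Rightarrow> (nat \<Rightarrow> nat) \<Rightarrow> (nat \<Rightarrow> nat) \<Rightarrow> (nat \<Rightarrow> int) \<Rightarrow> bool" where
  "determinantal TYPE('k) r l d m \<longleftrightarrow>
     (\<forall>\<nu>. \<nu> \<notin> {0, 1} \<longrightarrow>
        trivial_group (weyman_term r l d m \<nu> :: (nat \<times> nat \<Rightarrow> 'k cochain set) monoid))"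

definition defect :: "(nat \<Rightarrow> nat) \<Rightarrow> (nat \<Rightarrow> nat) \<Rightarrow> nat \<Rightarrow> int" where
  "defect l d k = int (l k) - \<lceil>real (l k) / real (d k)\<rceil>"

end

theory Submission
  imports Defs "HOL-Algebra.Generated_Groups"
begin

text \<open>
  The Cech complex of \<open>O(a)\<close> splits by exponent vectors \<open>e\<close>. The part at \<open>e\<close> consists of the scalar
  cochains on tuples of charts that hit every variable with a negative exponent in \<open>e\<close>. Its cohomology
  is that of a full simplex relative to a union of faces, one face per negative variable. Removing
  the negative variables one at a time by long exact sequences shows that it is acyclic if, in some
  factor, some but not all variables are negative. Otherwise it is concentrated in the degree
  \<open>\<Sum> l k\<close> over the factors \<open>k\<close> with all variables negative. This yields the vanishing half of the
  Kuenneth and Bott formulae.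

  For fixed \<open>p\<close>, the factors where \<open>m - p d\<close> is negative then form an upper set of \<open>[r]\<close>
  ordered by \<open>\<pi>\<close>, and the inequalities at its two boundary factors pin \<open>\<nu>\<close> to \<open>{0, 1}\<close>.
\<close>

section \<open>The alternating differential on tuples\<close>

fun tuple_diff :: "('a list \<Rightarrow> 'b::ab_group_add) \<Rightarrow> 'a list \<Rightarrow> 'b" where
  "tuple_diff f [] = 0"
| "tuple_diff f (c # s) = f s - tuple_diff (\<lambda>t. f (c # t)) s"

lemma tuple_diff_zero: "tuple_diff (\<lambda>t. 0) s = 0"
  by (induction s) auto

lemma tuple_diff_diff: "tuple_diff (\<lambda>t. f t - g t) s = tuple_diff f s - tuple_diff g s"
  by (induction s arbitrary: f g) auto

text \<open>With \<open>f_c t = f (c # t)\<close>, linearity turns the double differential of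
  \<open>f\<close> at \<open>c # s\<close> into \<open>tuple_diff f s - tuple_diff f s\<close> plus
  the double differential of \<open>f_c\<close> at \<open>s\<close>. The recursive form thus makes
  this a plain induction, with \<open>f\<close> arbitrary.\<close>

lemma tuple_diff_diff_eq_0: "tuple_diff (tuple_diff f) s = 0"
  by (induction s arbitrary: f) (auto simp: tuple_diff_diff)

lemma tuple_diff_cong:
  assumes "\<And>t. \<lbrakk>Suc (length t) = length s; set t \<subseteq> set s\<rbrakk> \<Longrightarrow> f t = g t"
  shows "tuple_diff f s = tuple_diff g s"
  using assms
proof (induction s arbitrary: f g)
  case (Cons c s)
  have "f s = g s"
    by (rule Cons.prems) auto
  moreover have "tuple_diff (\<lambda>t. f (c # t)) s = tuple_diff (\<lambda>t. g (c # t)) s"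
    by (rule Cons.IH, rule Cons.prems) auto
  ultimately show ?case by simp
qed simp

lemma tuple_diff_eq_0:
  assumes "\<And>t. \<lbrakk>Suc (length t) = length s; set t \<subseteq> set s\<rbrakk> \<Longrightarrow> f t = 0"
  shows "tuple_diff f s = 0"
  using tuple_diff_cong[of s f "\<lambda>_. 0"] assms by (simp add: tuple_diff_zero)

lemma tuple_diff_hom:
  assumes "\<And>x y. h (x - y) = h x - h y"
  shows "h (tuple_diff f s) = tuple_diff (\<lambda>t. h (f t)) s"
proof (induction s arbitrary: f)
  case Nil
  show ?case using assms[of 0 0] by simp
qed (simp add: assms)

text \<open>Ties the recursion to the formula in \<open>cech_diff\<close>: every face other than the
  first keeps the leading entry, and this shifts its index, hence its sign, by one.\<close>

lemma tuple_diff_eq_alternating_sum: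
  fixes f :: "'a list \<Rightarrow> 'b::ring_1"
  shows "tuple_diff f s = (\<Sum>j<length s. (-1) ^ j * f (take j s @ drop (Suc j) s))"
proof (induction s arbitrary: f)
  case (Cons c s)
  show ?case
    unfolding tuple_diff.simps Cons.IH length_Cons sum.lessThan_Suc_shift by (simp add: sum_negf)
qed simp

section \<open>Scalar cochains on covering tuples\<close>

definition covers :: "('a \<times> 'b) set \<Rightarrow> ('a \<Rightarrow> 'b) list \<Rightarrow> bool" where
  "covers N s \<longleftrightarrow> (\<forall>(k, i) \<in> N. \<exists>c \<in> set s. c k = i)"

text \<open>The condition \<open>s \<noteq> []\<close> keeps the complex unaugmented: for empty
  \<open>N\<close> the empty tuple would count as covering.\<close>

definition covering_cochains ::
    "('a \<Rightarrow> 'b) set \<Rightarrow> ('a \<times> 'b) set \<Rightarrow> nat \<Rightarrow> (('a \<Rightarrow> 'b) list \<Rightarrow> 'k::ab_group_add) set" where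
  "covering_cochains V N n =
     {f. \<forall>s. f s \<noteq> 0 \<longrightarrow> s \<noteq> [] \<and> length s = n \<and> set s \<subseteq> V \<and> covers N s}"

text \<open>Here \<open>n\<close> is the length of the tuples, so the cohomological degree is \<open>n - 1\<close>; for \<open>n = 0\<close>
  the truncated \<open>n - 1\<close> is harmless, since there are no nonzero cochains.\<close>

definition covering_exact ::
    "'k::ab_group_add itself \<Rightarrow> ('a \<Rightarrow> 'b) set \<Rightarrow> ('a \<times> 'b) set \<Rightarrow> nat \<Rightarrow> bool" where
  "covering_exact TYPE('k) V N n \<longleftrightarrow>
     (\<forall>f :: ('a \<Rightarrow> 'b) list \<Rightarrow> 'k. f \<in> covering_cochains V N n \<longrightarrow>
        (\<forall>s. set s \<subseteq> V \<longrightarrow> tuple_diff f s = 0) \<longrightarrow>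
        (\<exists>g \<in> covering_cochains V N (n - 1). \<forall>s. set s \<subseteq> V \<longrightarrow> tuple_diff g s = f s))"

lemma covers_mono: "covers N t \<Longrightarrow> set t \<subseteq> set s \<Longrightarrow> covers N s"
  unfolding covers_def by fast

lemma covers_insert: "covers (insert (k, i) N) s \<longleftrightarrow> covers N s \<and> (\<exists>c \<in> set s. c k = i)"
  unfolding covers_def by auto

lemma covering_exactI_trivial:
  assumes "\<And>f :: ('a \<Rightarrow> 'b) list \<Rightarrow> 'k. f \<in> covering_cochains V N n \<Longrightarrow> f = (\<lambda>_. 0)"
  shows "covering_exact TYPE('k::ab_group_add) V N n"
  unfolding covering_exact_def
proof (intro allI impI)
  fix f :: "('a \<Rightarrow> 'b) list \<Rightarrow> 'k"
  assume "f \<in> covering_cochains V N n"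
  then have "f = (\<lambda>_. 0)" by (rule assms)
  then show "\<exists>g \<in> covering_cochains V N (n - 1). \<forall>s. set s \<subseteq> V \<longrightarrow> tuple_diff g s = f s"
    by (intro bexI[of _ "\<lambda>_. 0"]) (auto simp: tuple_diff_zero covering_cochains_def)
qed

lemma covering_exact_0: "covering_exact TYPE('k::ab_group_add) V N 0"
  by (rule covering_exactI_trivial) (auto simp: covering_cochains_def)

lemma covering_exact_empty: "covering_exact TYPE('k::ab_group_add) {} N n"
  by (rule covering_exactI_trivial) (auto simp: covering_cochains_def)

text \<open>Prepending \<open>c0\<close> does not affect which members of \<open>N\<close> are hit,
  so it is a contracting homotopy. The excluded case is the degree-zero cohomology of a full
  simplex.\<close>

lemma covering_exact_cone:
  assumes "c0 \<in> V" and missed: "\<And>k i. (k, i) \<in> N \<Longrightarrow> c0 k \<noteq> i" and "N \<noteq> {} \<or> n \<noteq> 1"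
  shows "covering_exact TYPE('k::ab_group_add) V N n"
proof (cases "n = 0")
  case True
  then show ?thesis by (simp add: covering_exact_0)
next
  case False
  have covers_cone: "covers N (c0 # s) \<longleftrightarrow> covers N s" for s
    using missed unfolding covers_def by fastforce
  show ?thesis
    unfolding covering_exact_def
  proof (intro allI impI)
    fix f :: "('a \<Rightarrow> 'b) list \<Rightarrow> 'k"
    assume f: "f \<in> covering_cochains V N n"
      and cocycle: "\<forall>s. set s \<subseteq> V \<longrightarrow> tuple_diff f s = 0"
    \<comment> \<open>The primitive \<open>\<lambda>s. f (c0 # s)\<close> must vanish at the empty
      tuple to be an unaugmented cochain.\<close>
    have "f [c0] = 0"
    proof (rule ccontr)
      assume "f [c0] \<noteq> 0"
      then have "n = 1" "covers N []"
        using f covers_cone[of "[]"] by (auto simp: covering_cochains_def)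
      then show False
        using assms(3) by (auto simp: covers_def)
    qed
    then have "(\<lambda>s. f (c0 # s)) \<in> covering_cochains V N (n - 1)"
      using f covers_cone unfolding covering_cochains_def by fastforce
    moreover have "tuple_diff (\<lambda>s. f (c0 # s)) s = f s" if "set s \<subseteq> V" for s
      using cocycle[rule_format, of "c0 # s"] that assms(1) by simp
    ultimately show "\<exists>g \<in> covering_cochains V N (n - 1). \<forall>s. set s \<subseteq> V \<longrightarrow> tuple_diff g s = f s"
      by blast
  qed
qed

text \<open>Exactness in the middle of the long exact sequence of the short exact sequence given by
  restricting cochains to the tuples that avoid \<open>(k, i)\<close>.\<close>

lemma covering_exact_insert:
  assumes sub: "covering_exact TYPE('k::ab_group_add) {c \<in> V. c k \<noteq> i} N (n - 1)"
    and whole: "covering_exact TYPE('k) V N n"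
  shows "covering_exact TYPE('k) V (insert (k, i) N) n"
  unfolding covering_exact_def
proof (intro allI impI)
  fix f :: "('a \<Rightarrow> 'b) list \<Rightarrow> 'k"
  assume f: "f \<in> covering_cochains V (insert (k, i) N) n"
    and cocycle: "\<forall>s. set s \<subseteq> V \<longrightarrow> tuple_diff f s = 0"
  let ?V = "{c \<in> V. c k \<noteq> i}"
  have "f \<in> covering_cochains V N n"
    using f by (auto simp: covering_cochains_def covers_insert)
  then obtain g where g: "g \<in> covering_cochains V N (n - 1)"
    and dg: "\<And>s. set s \<subseteq> V \<Longrightarrow> tuple_diff g s = f s"
    using whole cocycle unfolding covering_exact_def by blast
  \<comment> \<open>A primitive \<open>g\<close> exists once \<open>(k, i)\<close> need not be hit;
    its restriction \<open>g'\<close> to tuples avoiding \<open>(k, i)\<close> is the obstruction to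
    lying in the smaller complex. It is a cocycle because \<open>f\<close> vanishes on those
    tuples.\<close>
  define g' where "g' s = (if set s \<subseteq> ?V then g s else 0)" for s
  have g': "g' \<in> covering_cochains ?V N (n - 1)"
    using g by (auto simp: covering_cochains_def g'_def split: if_splits)
  have cocycle': "tuple_diff g' s = 0" if s: "set s \<subseteq> ?V" for s
  proof -
    have "tuple_diff g' s = tuple_diff g s"
      using s by (intro tuple_diff_cong) (auto simp: g'_def)
    also have "\<dots> = f s" using s dg by auto
    also have "f s = 0"
      using f s by (auto simp: covering_cochains_def covers_insert)
    finally show ?thesis .
  qed
  obtain h where h: "h \<in> covering_cochains ?V N (n - 1 - 1)"
    and dh: "\<And>s. set s \<subseteq> ?V \<Longrightarrow> tuple_diff h s = g' s"
    using sub g' cocycle' unfolding covering_exact_def by blast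
  \<comment> \<open>Subtracting a coboundary preserves the differential of \<open>g\<close>, and
    this one cancels \<open>g\<close> on all tuples avoiding \<open>(k, i)\<close>.\<close>
  define u where "u s = (if set s \<subseteq> V then g s - tuple_diff h s else 0)" for s
  \<comment> \<open>The nonempty face \<open>t\<close> forces \<open>n - 1 - 1\<close> to be
    positive, so the truncated subtractions are genuine and \<open>length s = n - 1\<close>.\<close>
  have dh_supp: "s \<noteq> [] \<and> length s = n - 1 \<and> covers N s" if dhs: "tuple_diff h s \<noteq> 0" for s
  proof -
    obtain t where t: "Suc (length t) = length s" "set t \<subseteq> set s" "h t \<noteq> 0"
      using dhs tuple_diff_eq_0[of s h] by blast
    then have "t \<noteq> []" "length t = n - 1 - 1" "covers N t"
      using h by (auto simp: covering_cochains_def)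
    then show ?thesis
      using t covers_mono[of N t s] by (cases t) auto
  qed
  have "u \<in> covering_cochains V (insert (k, i) N) (n - 1)"
    unfolding covering_cochains_def
  proof (intro CollectI allI impI)
    fix s assume u: "u s \<noteq> 0"
    then have V: "set s \<subseteq> V" and "g s \<noteq> 0 \<or> tuple_diff h s \<noteq> 0"
      by (auto simp: u_def split: if_splits)
    then have *: "s \<noteq> [] \<and> length s = n - 1 \<and> covers N s"
      using dh_supp g by (auto simp: covering_cochains_def)
    have "\<exists>c \<in> set s. c k = i"
    proof (rule ccontr)
      assume "\<not> ?thesis"
      then have "set s \<subseteq> ?V" using V by auto
      then show False
        using u dh[of s] V by (simp add: u_def g'_def)
    qed
    with * V show "s \<noteq> [] \<and> length s = n - 1 \<and> set s \<subseteq> V \<and> covers (insert (k, i) N) s"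
      by (simp add: covers_insert)
  qed
  moreover have "tuple_diff u s = f s" if s: "set s \<subseteq> V" for s
  proof -
    have "tuple_diff u s = tuple_diff (\<lambda>t. g t - tuple_diff h t) s"
      using s by (intro tuple_diff_cong) (auto simp: u_def)
    then show ?thesis
      using dg[OF s] by (simp add: tuple_diff_diff tuple_diff_diff_eq_0)
  qed
  ultimately show "\<exists>g \<in> covering_cochains V (insert (k, i) N) (n - 1).
      \<forall>s. set s \<subseteq> V \<longrightarrow> tuple_diff g s = f s"
    by blast
qed

text \<open>Combinatorially, the tuples that miss some \<open>(k, i) \<in> N\<close> form a union of full simplices whose
  nerve is the join of the boundaries of the simplices on \<open>A k\<close>, over all \<open>k\<close> with
  \<open>N `` {k} = A k\<close>, as long as no \<open>N `` {k}\<close> is a nonempty proper subset of \<open>A k\<close>.\<close>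

lemma covering_exact_PiE:
  fixes A :: "'a \<Rightarrow> 'b set"
  assumes "finite I" and "\<And>k. k \<in> I \<Longrightarrow> finite (A k)" and "N \<subseteq> Sigma I A"
    and "(\<exists>k \<in> I. N `` {k} \<noteq> {} \<and> N `` {k} \<noteq> A k) \<or>
         n \<noteq> Suc (\<Sum>k | k \<in> I \<and> N `` {k} \<noteq> {}. card (A k) - 1)"
  shows "covering_exact TYPE('k::ab_group_add) (PiE I A) N n"
  using assms(2-4)
proof (induction "card N" arbitrary: N A n rule: less_induct)
  case less
  note finA = less.prems(1) and NA = less.prems(2) and deg = less.prems(3)
  have finN: "finite N"
    using finite_subset[OF NA] assms(1) finA by blast
  \<comment> \<open>If no fibre of \<open>N\<close> is all of \<open>A k\<close>, each factor has a
    coordinate outside \<open>N\<close>, and together these give a cone point. A full fibre supplies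
    a variable to remove from \<open>N\<close>.\<close>
  consider (empty) k where "k \<in> I" "A k = {}" | (cone) "\<forall>k \<in> I. A k \<noteq> {} \<and> N `` {k} \<noteq> A k"
    | (full) k where "\<forall>k \<in> I. A k \<noteq> {}" "k \<in> I" "N `` {k} = A k"
    by blast
  then show ?case
  proof cases
    case empty
    then have "PiE I A = {}" by (auto simp: PiE_eq_empty_iff)
    then show ?thesis by (simp add: covering_exact_empty)
  next
    case cone
    then have "\<forall>k \<in> I. \<exists>i. i \<in> A k \<and> (k, i) \<notin> N"
      using NA by fast
    then obtain c where c: "\<And>k. k \<in> I \<Longrightarrow> c k \<in> A k \<and> (k, c k) \<notin> N"
      by metis
    show ?thesis
    proof (rule covering_exact_cone)
      show "restrict c I \<in> PiE I A" using c by auto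
      show "restrict c I k \<noteq> i" if "(k, i) \<in> N" for k i
        using that c NA by auto
      \<comment> \<open>For empty \<open>N\<close> the sum in the degree hypothesis is
        \<open>0\<close>, so that hypothesis rules out \<open>n = 1\<close>.\<close>
      show "N \<noteq> {} \<or> n \<noteq> 1" using deg by auto
    qed
  next
    case (full k)
    then obtain i where i: "i \<in> A k" by auto
    define N' where "N' = N - {(k, i)}"
    define A' where "A' = A(k := A k - {i})"
    have ki: "(k, i) \<in> N" using i full by auto
    have less': "card N' < card N"
      unfolding N'_def using card_Diff1_less[OF finN ki] .
    have N: "N = insert (k, i) N'" using ki by (auto simp: N'_def)
    have V: "{c \<in> PiE I A. c k \<noteq> i} = PiE I A'"
      using full(2) unfolding A'_def
      by (auto simp: PiE_iff extensional_def split: if_splits)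
    have finA': "\<And>k. k \<in> I \<Longrightarrow> finite (A' k)" using finA by (auto simp: A'_def)
    have NA': "N' \<subseteq> Sigma I A'" using NA by (auto simp: N'_def A'_def split: if_splits)
    have NA0: "N' \<subseteq> Sigma I A" using NA by (auto simp: N'_def)
    have N'_k: "N' `` {k} = A k - {i}" using full(3) by (auto simp: N'_def)
    have N'_j: "N' `` {j} = N `` {j}" if "j \<noteq> k" for j using that by (auto simp: N'_def)
    have A'_j: "A' j = A j" if "j \<noteq> k" for j using that by (simp add: A'_def)
    let ?J = "{j \<in> I. N `` {j} \<noteq> {}}" and ?J' = "{j \<in> I. N' `` {j} \<noteq> {}}"
    have finJ: "finite ?J" using assms(1) by simp
    have kJ: "k \<in> ?J" using full i by auto
    have sumJ: "(\<Sum>j\<in>?J. card (A j) - 1) = (card (A k) - 1) + (\<Sum>j\<in>?J - {k}. card (A j) - 1)"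
      using finJ kJ by (rule sum.remove)
    \<comment> \<open>Shrinking \<open>A k\<close> by one point keeps the fibre over
      \<open>k\<close> full and lowers the critical degree by one, in step with
      \<open>n - 1\<close>. If \<open>A k = {i}\<close>, no charts remain; \<open>n = 0\<close> is
      separate because \<open>n - 1\<close> truncates.\<close>
    have sub: "covering_exact TYPE('k) (PiE I A') N' (n - 1)"
    proof (cases "A k = {i} \<or> n = 0")
      case True
      then show ?thesis
      proof
        assume "A k = {i}"
        then have "PiE I A' = {}" using full(2) by (auto simp: PiE_eq_empty_iff A'_def)
        then show ?thesis by (simp add: covering_exact_empty)
      qed (simp add: covering_exact_0)
    next
      case False
      then have ne: "A k - {i} \<noteq> {}" using i by auto
      have cardA': "card (A' k) - 1 = card (A k) - 2"
        using i finA full(2) by (simp add: A'_def)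
      have "card (A k - {i}) > 0"
        using ne finA full(2) by (simp add: card_gt_0_iff)
      then have card2: "card (A k) \<ge> 2"
        using i finA full(2) by simp
      have J': "?J' = ?J"
      proof -
        have "N' `` {j} \<noteq> {} \<longleftrightarrow> N `` {j} \<noteq> {}" for j
          using ne N'_k N'_j full(3) i by (cases "j = k") auto
        then show ?thesis by simp
      qed
      have "(\<Sum>j\<in>?J. card (A' j) - 1) = (card (A' k) - 1) + (\<Sum>j\<in>?J - {k}. card (A' j) - 1)"
        using finJ kJ by (rule sum.remove)
      also have "(\<Sum>j\<in>?J - {k}. card (A' j) - 1) = (\<Sum>j\<in>?J - {k}. card (A j) - 1)"
        by (rule sum.cong) (auto simp: A'_j)
      finally have "Suc (\<Sum>j\<in>?J. card (A' j) - 1) = (\<Sum>j\<in>?J. card (A j) - 1)"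
        using sumJ cardA' card2 by simp
      with J' have sumJ': "(\<Sum>j\<in>?J. card (A j) - 1) = Suc (\<Sum>j\<in>?J'. card (A' j) - 1)"
        by simp
      have "(\<exists>j \<in> I. N' `` {j} \<noteq> {} \<and> N' `` {j} \<noteq> A' j) \<or> n - 1 \<noteq> Suc (\<Sum>j\<in>?J'. card (A' j) - 1)"
      proof (cases "\<exists>j \<in> I. N `` {j} \<noteq> {} \<and> N `` {j} \<noteq> A j")
        case True
        then obtain j where "j \<in> I" "N `` {j} \<noteq> {}" "N `` {j} \<noteq> A j" by blast
        then show ?thesis using full(3) N'_j A'_j by (metis)
      next
        case False
        then have "n \<noteq> Suc (\<Sum>j\<in>?J. card (A j) - 1)" using deg by blast
        then show ?thesis using sumJ' \<open>\<not> (A k = {i} \<or> n = 0)\<close> by auto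
      qed
      then show ?thesis
        using less.hyps[OF less' finA' NA'] by blast
    qed
    \<comment> \<open>With \<open>A k\<close> unchanged, the fibre over \<open>k\<close> has become
      a proper subset. It is nonempty, giving the first alternative, unless
      \<open>A k = {i}\<close>; then \<open>k\<close> leaves the index set but contributed
      \<open>0\<close> to the sum.\<close>
    have whole: "covering_exact TYPE('k) (PiE I A) N' n"
    proof -
      have "(\<exists>j \<in> I. N' `` {j} \<noteq> {} \<and> N' `` {j} \<noteq> A j) \<or> n \<noteq> Suc (\<Sum>j\<in>?J'. card (A j) - 1)"
      proof (cases "\<exists>j \<in> I. N `` {j} \<noteq> {} \<and> N `` {j} \<noteq> A j")
        case True
        then obtain j where "j \<in> I" "N `` {j} \<noteq> {}" "N `` {j} \<noteq> A j" by blast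
        then show ?thesis using full(3) N'_j by metis
      next
        case False
        then have n: "n \<noteq> Suc (\<Sum>j\<in>?J. card (A j) - 1)" using deg by blast
        show ?thesis
        proof (cases "A k = {i}")
          case True
          have "N' `` {j} \<noteq> {} \<longleftrightarrow> N `` {j} \<noteq> {} \<and> j \<noteq> k" for j
            using True N'_k N'_j by (cases "j = k") auto
          then have "?J' = ?J - {k}" by auto
          then show ?thesis using n sumJ True by simp
        next
          case False
          then show ?thesis using N'_k i full(2) by blast
        qed
      qed
      then show ?thesis
        using less.hyps[OF less' finA NA0] by blast
    qed
    show ?thesis
      unfolding N by (rule covering_exact_insert) (use sub whole V in simp_all)
  qed
qed

section \<open>Laurent monomials and sections over intersections of charts\<close>

text \<open>The monomial is a unit, so the general inclusion for products, applied to
  \<open>u\<close> and to \<open>- u\<close>, yields both directions.\<close>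

lemma keys_single_one_mult:
  fixes f :: "('a::ab_group_add) \<Rightarrow>\<^sub>0 ('b::comm_ring_1)"
  shows "Poly_Mapping.keys (Poly_Mapping.single u 1 * f) = (+) u ` Poly_Mapping.keys f"
proof -
  have sub: "Poly_Mapping.keys (Poly_Mapping.single v 1 * h) \<subseteq> (+) v ` Poly_Mapping.keys h"
    for v :: 'a and h :: "'a \<Rightarrow>\<^sub>0 'b"
    using keys_mult[of "Poly_Mapping.single v 1" h] by auto
  have "f = Poly_Mapping.single (- u) 1 * (Poly_Mapping.single u 1 * f)"
    by (simp add: mult.assoc[symmetric] mult_single)
  then have "Poly_Mapping.keys f
      \<subseteq> (+) (- u) ` Poly_Mapping.keys (Poly_Mapping.single u 1 * f)"
    using sub[of "- u" "Poly_Mapping.single u 1 * f"] by simp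
  then have "(+) u ` Poly_Mapping.keys f
      \<subseteq> (+) u ` (+) (- u) ` Poly_Mapping.keys (Poly_Mapping.single u 1 * f)"
    by (rule image_mono)
  also have "\<dots> = Poly_Mapping.keys (Poly_Mapping.single u 1 * f)"
    by (simp add: image_image)
  finally show ?thesis using sub by blast
qed

lemma prod_single_one:
  "(\<Prod>x\<in>A. Poly_Mapping.single (e x) (1::'b::comm_semiring_1))
     = Poly_Mapping.single (\<Sum>x\<in>A. e x) 1" for e :: "'a \<Rightarrow> 'c::comm_monoid_add"
  by (induction A rule: infinite_finite_induct) (auto simp: mult_single)

lemma single_one_power:
  "Poly_Mapping.single e (1::'b::comm_semiring_1) ^ N = Poly_Mapping.single (\<Sum>_<N. e) 1"
  for e :: "'c::comm_monoid_add"
  by (induction N) (auto simp: mult_single add.commute)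

definition chart_vars :: "nat \<Rightarrow> (nat \<Rightarrow> nat) set \<Rightarrow> (nat \<times> nat) set" where
  "chart_vars r S = {(k, i). k \<in> {1..r} \<and> (\<exists>c \<in> S. c k = i)}"

definition negative_vars :: "expo \<Rightarrow> (nat \<times> nat) set" where
  "negative_vars e = {v. Poly_Mapping.lookup e v < 0}"

text \<open>The exponent vector of the monomial inverted in \<open>sections\<close>; its support is
  \<open>chart_vars r S\<close> for finite \<open>S\<close>.\<close>

definition chart_expo :: "nat \<Rightarrow> (nat \<Rightarrow> nat) set \<Rightarrow> expo" where
  "chart_expo r S = (\<Sum>c\<in>S. \<Sum>k=1..r. Poly_Mapping.single (k, c k) 1)"

lemma chart_expo_nonneg: "0 \<le> Poly_Mapping.lookup (chart_expo r S) v"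
  unfolding chart_expo_def lookup_sum by (intro sum_nonneg) (auto simp: lookup_single when_def)

lemma chart_expo_pos_iff:
  assumes "finite S"
  shows "0 < Poly_Mapping.lookup (chart_expo r S) v \<longleftrightarrow> v \<in> chart_vars r S"
proof -
  have "0 < Poly_Mapping.lookup (chart_expo r S) v \<longleftrightarrow> Poly_Mapping.lookup (chart_expo r S) v \<noteq> 0"
    using chart_expo_nonneg[of r S v] by linarith
  also have "\<dots> \<longleftrightarrow> (\<exists>c\<in>S. \<exists>k\<in>{1..r}. v = (k, c k))"
    unfolding chart_expo_def lookup_sum using assms
    by (auto simp: sum_nonneg_eq_0_iff sum_nonneg lookup_single when_def)
  finally show ?thesis by (auto simp: chart_vars_def)
qed

text \<open>A power of the inverted monomial clears exactly the denominators in its own variables,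
  and one power serves all of \<open>f\<close> because \<open>f\<close> has finitely many
  terms.\<close>

lemma sections_iff:
  fixes f :: "'k::field laurent"
  assumes "finite S" and S: "S \<subseteq> charts r l"
  shows "f \<in> sections r l a S \<longleftrightarrow> multihomogeneous r l a f \<and>
    (\<forall>e \<in> Poly_Mapping.keys f. Poly_Mapping.keys e \<subseteq> (SIGMA k:{1..r}. {0..l k}) \<and>
       negative_vars e \<subseteq> chart_vars r S)"
proof -
  let ?X = "SIGMA k:{1..r}. {0..l k}"
  let ?M = "\<lambda>N::nat. \<Sum>_<N. chart_expo r S"
  have mon: "(\<Prod>c\<in>S. \<Prod>k=1..r. coord k (c k)) ^ N = (Poly_Mapping.single (?M N) 1 :: 'k laurent)" for N
    by (simp add: coord_def prod_single_one single_one_power chart_expo_def)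
  have lookupM: "Poly_Mapping.lookup (?M N + e) v
      = int N * Poly_Mapping.lookup (chart_expo r S) v + Poly_Mapping.lookup e v" for N e v
    by (simp add: lookup_add lookup_sum)
  have varsX: "chart_vars r S \<subseteq> ?X"
    using S by (auto simp: chart_vars_def charts_def PiE_iff)
  have outside: "Poly_Mapping.lookup (chart_expo r S) v = 0" if "v \<notin> chart_vars r S" for v
    using chart_expo_pos_iff[OF assms(1), of r v] chart_expo_nonneg[of r S v] that by linarith
  \<comment> \<open>The inverted monomial involves only variables in \<open>?X\<close>, so it cannot
    alter exponents outside \<open>?X\<close>.\<close>
  have keysM: "Poly_Mapping.keys (?M N + e) \<subseteq> ?X \<longleftrightarrow> Poly_Mapping.keys e \<subseteq> ?X" for N e
  proof -
    have "v \<in> Poly_Mapping.keys (?M N + e) \<longleftrightarrow> v \<in> Poly_Mapping.keys e" if "v \<notin> ?X" for v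
      unfolding in_keys_iff lookupM using outside[OF contra_subsetD[OF varsX that]] by simp
    then show ?thesis by blast
  qed
  have ring: "(\<Prod>c\<in>S. \<Prod>k=1..r. coord k (c k)) ^ N * f \<in> coord_ring r l \<longleftrightarrow>
     (\<forall>e \<in> Poly_Mapping.keys f. Poly_Mapping.keys e \<subseteq> ?X \<and>
        (\<forall>v. 0 \<le> int N * Poly_Mapping.lookup (chart_expo r S) v + Poly_Mapping.lookup e v))" for N
    unfolding mon coord_ring_def mem_Collect_eq keys_single_one_mult ball_simps keysM lookupM ..
  have "(\<exists>N. \<forall>e \<in> Poly_Mapping.keys f. Poly_Mapping.keys e \<subseteq> ?X \<and>
          (\<forall>v. 0 \<le> int N * Poly_Mapping.lookup (chart_expo r S) v + Poly_Mapping.lookup e v)) \<longleftrightarrow>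
        (\<forall>e \<in> Poly_Mapping.keys f. Poly_Mapping.keys e \<subseteq> ?X \<and> negative_vars e \<subseteq> chart_vars r S)"
    (is "?L \<longleftrightarrow> ?R")
  proof
    assume ?L
    then obtain N where N: "\<And>e. e \<in> Poly_Mapping.keys f \<Longrightarrow> Poly_Mapping.keys e \<subseteq> ?X"
      "\<And>e v. e \<in> Poly_Mapping.keys f \<Longrightarrow>
          0 \<le> int N * Poly_Mapping.lookup (chart_expo r S) v + Poly_Mapping.lookup e v"
      by blast
    have "v \<in> chart_vars r S" if "e \<in> Poly_Mapping.keys f" "v \<in> negative_vars e" for e v
      using N(2)[OF that(1), of v] that(2) outside[of v]
      by (cases "v \<in> chart_vars r S") (auto simp: negative_vars_def)
    with N(1) show ?R by blast
  next
    assume R: ?R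
    \<comment> \<open>A crude bound on the absolute value of every exponent occurring in
      \<open>f\<close>.\<close>
    define N where "N = (\<Sum>e\<in>Poly_Mapping.keys f. \<Sum>v\<in>Poly_Mapping.keys e. nat \<bar>Poly_Mapping.lookup e v\<bar>)"
    have "0 \<le> int N * Poly_Mapping.lookup (chart_expo r S) v + Poly_Mapping.lookup e v"
      if e: "e \<in> Poly_Mapping.keys f" for e v
    proof (cases "Poly_Mapping.lookup e v < 0")
      case False
      then show ?thesis using chart_expo_nonneg[of r S v] by simp
    next
      case True
      then have "v \<in> chart_vars r S" using R e by (auto simp: negative_vars_def)
      then have pos: "1 \<le> Poly_Mapping.lookup (chart_expo r S) v"
        using chart_expo_pos_iff[OF assms(1), of r v] by simp
      have v: "v \<in> Poly_Mapping.keys e" using True by (simp add: in_keys_iff)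
      have "nat \<bar>Poly_Mapping.lookup e v\<bar> \<le> (\<Sum>v\<in>Poly_Mapping.keys e. nat \<bar>Poly_Mapping.lookup e v\<bar>)"
        using v by (intro member_le_sum) auto
      also have "\<dots> \<le> N"
        unfolding N_def using e
        by (intro member_le_sum[where f = "\<lambda>e. \<Sum>v\<in>Poly_Mapping.keys e. nat \<bar>Poly_Mapping.lookup e v\<bar>"]) auto
      finally have "- Poly_Mapping.lookup e v \<le> int N" using True by linarith
      also have "int N \<le> int N * Poly_Mapping.lookup (chart_expo r S) v"
        using mult_left_mono[OF pos, of "int N"] by simp
      finally show ?thesis by simp
    qed
    with R show ?L by blast
  qed
  then show ?thesis
    unfolding sections_def mem_Collect_eq ring by simp
qed

section \<open>The Cech complex, one exponent at a time\<close>

lemma finite_charts: "finite (charts r l)"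
  unfolding charts_def by (intro finite_PiE) auto

lemma finite_chart_tuples: "finite (chart_tuples r l q)"
proof (rule finite_subset)
  show "chart_tuples r l q \<subseteq> {s. set s \<subseteq> charts r l \<and> length s = nat (q + 1)}"
    by (auto simp: chart_tuples_def)
qed (simp add: finite_lists_length_eq finite_charts)

text \<open>The exponent \<open>e\<close> occurs among the sections on the intersection over a tuple \<open>s\<close> exactly if
  \<open>s\<close> covers the variables with negative exponents.\<close>

definition allowed :: "nat \<Rightarrow> (nat \<Rightarrow> nat) \<Rightarrow> (nat \<Rightarrow> int) \<Rightarrow> expo \<Rightarrow> bool" where
  "allowed r l a e \<longleftrightarrow> Poly_Mapping.keys e \<subseteq> (SIGMA k:{1..r}. {0..l k}) \<and>
     (\<forall>k \<in> {1..r}. (\<Sum>i=0..l k. Poly_Mapping.lookup e (k, i)) = a k)"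

lemma negative_vars_subset:
  assumes "allowed r l a e"
  shows "negative_vars e \<subseteq> (SIGMA k:{1..r}. {0..l k})"
proof -
  have "negative_vars e \<subseteq> Poly_Mapping.keys e"
    by (auto simp: negative_vars_def in_keys_iff)
  then show ?thesis using assms unfolding allowed_def by blast
qed

lemma sections_set_iff:
  fixes f :: "'k::field laurent"
  assumes "set s \<subseteq> charts r l"
  shows "f \<in> sections r l a (set s) \<longleftrightarrow>
    (\<forall>e \<in> Poly_Mapping.keys f. allowed r l a e \<and> covers (negative_vars e) s)"
proof -
  have "negative_vars e \<subseteq> chart_vars r (set s) \<longleftrightarrow> covers (negative_vars e) s"
    if "allowed r l a e" for e
    using negative_vars_subset[OF that] unfolding covers_def chart_vars_def by fast
  then show ?thesis
    unfolding sections_iff[OF finite_set assms] multihomogeneous_def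
    by (auto simp: allowed_def)
qed

text \<open>Membership becomes a condition on each exponent separately, which is what splits the
  complex. Off the tuples the second clause is vacuous, since \<open>f s\<close> has no keys
  there.\<close>

lemma cech_cochains_carrier:
  "f \<in> carrier (cech_cochains r l a q) \<longleftrightarrow>
     (\<forall>s. f s \<noteq> 0 \<longrightarrow> s \<in> chart_tuples r l q) \<and>
     (\<forall>s. \<forall>e \<in> Poly_Mapping.keys (f s). allowed r l a e \<and> covers (negative_vars e) s)"
proof -
  have "f s \<in> sections r l a (set s) \<longleftrightarrow>
      (\<forall>e \<in> Poly_Mapping.keys (f s). allowed r l a e \<and> covers (negative_vars e) s)"
    if "s \<in> chart_tuples r l q" for s
    using that by (intro sections_set_iff) (simp add: chart_tuples_def)
  then show ?thesis
    unfolding cech_cochains_def by auto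
qed

lemma cech_diff_eq:
  "cech_diff r l q f = (\<lambda>s. if s \<in> chart_tuples r l (q + 1) then tuple_diff f s else 0)"
  unfolding cech_diff_def tuple_diff_eq_alternating_sum ..

lemma comm_group_cech_cochains: "comm_group (cech_cochains r l a q)"
proof (rule comm_groupI)
  fix f g h :: "'a cochain"
  let ?C = "cech_cochains r l a q"
  assume f: "f \<in> carrier ?C"
  have "(\<lambda>s. - f s) \<in> carrier ?C"
    using f by (auto simp: cech_cochains_carrier in_keys_iff)
  then show "\<exists>g \<in> carrier ?C. g \<otimes>\<^bsub>?C\<^esub> f = \<one>\<^bsub>?C\<^esub>"
    by (rule rev_bexI) (simp add: cech_cochains_def)
  assume g: "g \<in> carrier ?C"
  have "f s + g s \<noteq> 0 \<Longrightarrow> f s \<noteq> 0 \<or> g s \<noteq> 0" for s by auto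
  moreover have "e \<in> Poly_Mapping.keys (f s + g s) \<Longrightarrow>
      e \<in> Poly_Mapping.keys (f s) \<or> e \<in> Poly_Mapping.keys (g s)" for e s
    using Poly_Mapping.keys_add[of "f s" "g s"] by blast
  ultimately have "(\<lambda>s. f s + g s) \<in> carrier ?C"
    using f g unfolding cech_cochains_carrier by blast
  then show "f \<otimes>\<^bsub>?C\<^esub> g \<in> carrier ?C"
    by (simp add: cech_cochains_def)
qed (auto simp: cech_cochains_def add.assoc add.commute sections_def multihomogeneous_def coord_ring_def)

lemma tuple_diff_nonzeroE:
  assumes "tuple_diff f s \<noteq> 0"
  obtains t where "Suc (length t) = length s" "set t \<subseteq> set s" "f t \<noteq> 0"
  using assms tuple_diff_eq_0[of s f] by blast

lemma lookup_tuple_diff: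
  "Poly_Mapping.lookup (tuple_diff f s) e = tuple_diff (\<lambda>t. Poly_Mapping.lookup (f t) e) s"
  by (rule tuple_diff_hom[of "\<lambda>x. Poly_Mapping.lookup x e"]) (simp add: lookup_minus)

lemma cech_diff_closed:
  assumes f: "f \<in> carrier (cech_cochains r l a q)"
  shows "cech_diff r l q f \<in> carrier (cech_cochains r l a (q + 1))"
proof -
  have "allowed r l a e \<and> covers (negative_vars e) s"
    if "e \<in> Poly_Mapping.keys (tuple_diff f s)" for e s
  proof -
    have "tuple_diff (\<lambda>t. Poly_Mapping.lookup (f t) e) s \<noteq> 0"
      using that by (simp add: in_keys_iff lookup_tuple_diff)
    then obtain t where t: "set t \<subseteq> set s" "Poly_Mapping.lookup (f t) e \<noteq> 0"
      by (rule tuple_diff_nonzeroE)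
    then have "allowed r l a e" "covers (negative_vars e) t"
      using f by (auto simp: cech_cochains_carrier in_keys_iff)
    then show ?thesis using t(1) covers_mono by blast
  qed
  then show ?thesis
    unfolding cech_cochains_carrier cech_diff_eq by auto
qed

text \<open>Cutting \<open>tuple_diff f\<close> off outside the tuples of the right length changes
  nothing over \<open>charts r l\<close>: at any other length all faces carry the value
  \<open>0\<close>.\<close>

lemma tuple_diff_cech_diff:
  assumes f: "f \<in> carrier (cech_cochains r l a q)" and s: "set s \<subseteq> charts r l"
  shows "tuple_diff (cech_diff r l q f) s = 0"
proof -
  have "tuple_diff (cech_diff r l q f) s = tuple_diff (tuple_diff f) s"
  proof (rule tuple_diff_cong)
    fix t assume t: "set t \<subseteq> set s"
    show "cech_diff r l q f t = tuple_diff f t"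
    proof (cases "t \<in> chart_tuples r l (q + 1)")
      case False
      have "tuple_diff f t = 0"
      proof (rule tuple_diff_eq_0)
        fix u assume u: "Suc (length u) = length t" "set u \<subseteq> set t"
        show "f u = 0"
        proof (rule ccontr)
          assume "f u \<noteq> 0"
          then have "u \<in> chart_tuples r l q" using f by (simp add: cech_cochains_carrier)
          then show False using False u t s by (auto simp: chart_tuples_def)
        qed
      qed
      then show ?thesis using False by (simp add: cech_diff_eq)
    qed (simp add: cech_diff_eq)
  qed
  then show ?thesis by (simp add: tuple_diff_diff_eq_0)
qed

lemma tuple_diff_eq_0_of_cech_diff:
  assumes f: "f \<in> carrier (cech_cochains r l a q)" and "cech_diff r l q f = (\<lambda>_. 0)"
    and s: "set s \<subseteq> charts r l"
  shows "tuple_diff f s = 0"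
proof (rule ccontr)
  assume ne: "tuple_diff f s \<noteq> 0"
  then obtain t where t: "Suc (length t) = length s" "f t \<noteq> 0"
    by (rule tuple_diff_nonzeroE)
  then have "t \<in> chart_tuples r l q" using f by (simp add: cech_cochains_carrier)
  then have "s \<in> chart_tuples r l (q + 1)" using t s by (auto simp: chart_tuples_def)
  then show False using ne fun_cong[OF assms(2), of s] by (simp add: cech_diff_eq)
qed

text \<open>Finitely many tuples carry finitely many exponents in all, so the scalar primitives for
  the single exponents assemble into Laurent polynomials.\<close>

lemma cech_exact:
  fixes f :: "'k::field cochain"
  assumes "0 \<le> q"
    and exact: "\<And>e. allowed r l a e \<Longrightarrow>
      covering_exact TYPE('k) (charts r l) (negative_vars e) (nat (q + 1))"
    and f: "f \<in> carrier (cech_cochains r l a q)" and cocycle: "cech_diff r l q f = (\<lambda>_. 0)"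
  shows "\<exists>g \<in> carrier (cech_cochains r l a (q - 1)). cech_diff r l (q - 1) g = f"
proof -
  let ?n = "nat (q + 1)" and ?V = "charts r l"
  define E where "E = (\<Union>s\<in>chart_tuples r l q. Poly_Mapping.keys (f s))"
  have finE: "finite E" unfolding E_def by (intro finite_UN_I finite_chart_tuples finite_keys)
  have "\<exists>g \<in> covering_cochains ?V (negative_vars e) (?n - 1).
      \<forall>s. set s \<subseteq> ?V \<longrightarrow> tuple_diff g s = Poly_Mapping.lookup (f s) e" if "e \<in> E" for e
  proof -
    have "allowed r l a e" using that f unfolding E_def cech_cochains_carrier by blast
    moreover have "(\<lambda>s. Poly_Mapping.lookup (f s) e) \<in> covering_cochains ?V (negative_vars e) ?n"
    proof -
      have "s \<in> chart_tuples r l q \<and> covers (negative_vars e) s"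
        if "Poly_Mapping.lookup (f s) e \<noteq> 0" for s
      proof -
        have "f s \<noteq> 0" "e \<in> Poly_Mapping.keys (f s)" using that by (auto simp: in_keys_iff)
        then show ?thesis using f unfolding cech_cochains_carrier by blast
      qed
      then show ?thesis
        unfolding covering_cochains_def chart_tuples_def by fastforce
    qed
    moreover have "tuple_diff (\<lambda>s. Poly_Mapping.lookup (f s) e) s = 0" if "set s \<subseteq> ?V" for s
      using tuple_diff_eq_0_of_cech_diff[OF f cocycle that]
      by (simp add: lookup_tuple_diff[symmetric])
    ultimately show ?thesis
      using exact unfolding covering_exact_def by blast
  qed
  then obtain G where G: "\<And>e. e \<in> E \<Longrightarrow> G e \<in> covering_cochains ?V (negative_vars e) (?n - 1)"
    and dG: "\<And>e s. e \<in> E \<Longrightarrow> set s \<subseteq> ?V \<Longrightarrow> tuple_diff (G e) s = Poly_Mapping.lookup (f s) e"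
    by metis
  define g where "g s = (\<Sum>e\<in>E. Poly_Mapping.single e (G e s))" for s
  have lookup_g: "Poly_Mapping.lookup (g s) e = (if e \<in> E then G e s else 0)" for s e
    unfolding g_def lookup_sum using finE by (simp add: lookup_single when_def)
  have keys_g: "e \<in> E \<and> G e s \<noteq> 0" if "e \<in> Poly_Mapping.keys (g s)" for e s
    using that by (auto simp: in_keys_iff lookup_g split: if_splits)
  have g: "g \<in> carrier (cech_cochains r l a (q - 1))"
    unfolding cech_cochains_carrier
  proof (intro conjI allI impI ballI)
    fix s assume "g s \<noteq> 0"
    then obtain e where "e \<in> Poly_Mapping.keys (g s)" by fastforce
    then have "s \<noteq> []" "length s = ?n - 1" "set s \<subseteq> ?V"
      using keys_g[of e s] G[of e] by (auto simp: covering_cochains_def)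
    \<comment> \<open>Here \<open>0 \<le> q\<close> gives \<open>nat (q + 1) - 1 = nat q\<close>,
      the tuple length in degree \<open>q - 1\<close>.\<close>
    then show "s \<in> chart_tuples r l (q - 1)"
      using assms(1) by (simp add: chart_tuples_def nat_add_distrib)
  next
    fix s e assume "e \<in> Poly_Mapping.keys (g s)"
    then have e: "e \<in> E" "G e s \<noteq> 0" using keys_g by auto
    then show "covers (negative_vars e) s" using G[of e] by (auto simp: covering_cochains_def)
    show "allowed r l a e" using e f unfolding E_def cech_cochains_carrier by blast
  qed
  have "cech_diff r l (q - 1) g s = f s" for s
  proof (cases "s \<in> chart_tuples r l q")
    case True
    then have s: "set s \<subseteq> ?V" by (simp add: chart_tuples_def)
    have "tuple_diff g s = f s"
    proof (rule poly_mapping_eqI)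
      fix e
      show "Poly_Mapping.lookup (tuple_diff g s) e = Poly_Mapping.lookup (f s) e"
      proof (cases "e \<in> E")
        case True
        then show ?thesis using dG[OF True s] by (simp add: lookup_tuple_diff lookup_g)
      next
        case False
        then have "e \<notin> Poly_Mapping.keys (f s)" using \<open>s \<in> chart_tuples r l q\<close> E_def by blast
        then show ?thesis
          using False by (simp add: lookup_tuple_diff lookup_g tuple_diff_zero in_keys_iff)
      qed
    qed
    then show ?thesis using True by (simp add: cech_diff_eq)
  next
    case False
    then show ?thesis using f by (auto simp: cech_diff_eq cech_cochains_carrier)
  qed
  then show ?thesis using g by blast
qed

section \<open>Vanishing of line bundle cohomology\<close>

lemma (in group) trivial_group_self_factor: "trivial_group (G Mod carrier G)"
proof -
  interpret N: normal "carrier G" G by (rule normal_self)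
  have "carrier G #> x = carrier G" if "x \<in> carrier G" for x
    using that by (simp add: coset_join2 subgroup_self)
  then have "carrier (G Mod carrier G) \<subseteq> {carrier G}"
    by (auto simp: carrier_FactGroup)
  then show ?thesis
    using group.trivial_group_alt[OF N.factorgroup_is_group] by blast
qed

lemma trivial_cohomology:
  assumes exact: "\<And>e. 0 \<le> q \<Longrightarrow> allowed r l a e \<Longrightarrow>
      covering_exact TYPE('k) (charts r l) (negative_vars e) (nat (q + 1))"
  shows "trivial_group (cohomology r l q a :: 'k::field cochain set monoid)"
proof -
  let ?C = "\<lambda>q. cech_cochains r l a q :: 'k cochain monoid"
  let ?K = "kernel (?C q) (?C (q + 1)) (cech_diff r l q)"
  interpret C: comm_group "?C q" by (rule comm_group_cech_cochains)
  interpret C': comm_group "?C (q + 1)" by (rule comm_group_cech_cochains)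
  have tuple_diff_add: "tuple_diff (\<lambda>s. f s + g s) s = tuple_diff f s + tuple_diff g s"
    for f g :: "'k cochain" and s
    using tuple_diff_diff[of "\<lambda>s. f s + g s" g s] by (simp add: algebra_simps)
  interpret d: group_hom "?C q" "?C (q + 1)" "cech_diff r l q"
    by unfold_locales
      (auto simp: hom_def cech_diff_closed, auto simp: cech_cochains_def cech_diff_eq tuple_diff_add)
  have one: "\<one>\<^bsub>?C (q + 1)\<^esub> = (\<lambda>_. 0)" by (simp add: cech_cochains_def)
  have "cech_diff r l (q - 1) ` carrier (?C (q - 1)) = ?K"
  proof
    show "cech_diff r l (q - 1) ` carrier (?C (q - 1)) \<subseteq> ?K"
    proof
      fix f assume "f \<in> cech_diff r l (q - 1) ` carrier (?C (q - 1))"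
      then obtain g where g: "g \<in> carrier (?C (q - 1))" "f = cech_diff r l (q - 1) g" by blast
      have "cech_diff r l q f s = 0" for s
        using tuple_diff_cech_diff[OF g(1), of s] g(2)
        by (auto simp: cech_diff_eq[of r l q] chart_tuples_def)
      moreover have "f \<in> carrier (?C q)" using cech_diff_closed[OF g(1)] g(2) by simp
      ultimately show "f \<in> ?K" unfolding kernel_def one by auto
    qed
    show "?K \<subseteq> cech_diff r l (q - 1) ` carrier (?C (q - 1))"
    proof
      fix f assume "f \<in> ?K"
      then have f: "f \<in> carrier (?C q)" "cech_diff r l q f = (\<lambda>_. 0)"
        by (auto simp: kernel_def one)
      show "f \<in> cech_diff r l (q - 1) ` carrier (?C (q - 1))"
      proof (cases "0 \<le> q")
        case True
        then show ?thesis using cech_exact[OF True exact[OF True] f] by blast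
      next
        case False
        \<comment> \<open>In negative degree a tuple would have length at most \<open>0\<close>, but
          the empty tuple is excluded.\<close>
        then have "f s = 0" for s
          using f(1) by (auto simp: cech_cochains_carrier chart_tuples_def simp flip: length_greater_0_conv)
        then have "f = cech_diff r l (q - 1) (\<lambda>_. 0)"
          by (auto simp: cech_diff_eq tuple_diff_zero)
        moreover have "(\<lambda>_. 0) \<in> carrier (?C (q - 1))"
          by (simp add: cech_cochains_carrier)
        ultimately show ?thesis by blast
      qed
    qed
  qed
  moreover have "group (?C q \<lparr>carrier := ?K\<rparr>)"
    by (rule subgroup.subgroup_is_group[OF d.subgroup_kernel C.is_group])
  ultimately show ?thesis
    unfolding cohomology_def using group.trivial_group_self_factor by fastforce
qed

text \<open>An exponent obstructs exactness only if in each factor none or all of its variables are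
  negative. The exponents of factor \<open>k\<close> add up to \<open>a k\<close>, so these cases
  force \<open>0 \<le> a k\<close> or \<open>a k < - int (l k)\<close>, and the critical degree
  becomes the sum of \<open>l k\<close> over negative \<open>a k\<close>.\<close>

lemma cohomology_vanishing:
  assumes "\<not> ((\<forall>k \<in> {1..r}. 0 \<le> a k \<or> a k < - int (l k)) \<and>
      q = (\<Sum>k | k \<in> {1..r} \<and> a k < 0. int (l k)))"
  shows "trivial_group (cohomology r l q a :: 'k::field cochain set monoid)"
proof (rule trivial_cohomology)
  fix e assume q: "0 \<le> q" and e: "allowed r l a e"
  let ?N = "negative_vars e" and ?A = "\<lambda>k. {0..l k}"
  have sum_e: "(\<Sum>i=0..l k. Poly_Mapping.lookup e (k, i)) = a k" if "k \<in> {1..r}" for k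
    using e that by (auto simp: allowed_def)
  have "(\<exists>k \<in> {1..r}. ?N `` {k} \<noteq> {} \<and> ?N `` {k} \<noteq> ?A k) \<or>
      nat (q + 1) \<noteq> Suc (\<Sum>k | k \<in> {1..r} \<and> ?N `` {k} \<noteq> {}. card (?A k) - 1)"
  proof (rule ccontr)
    assume "\<not> ?thesis"
    then have N: "\<And>k. k \<in> {1..r} \<Longrightarrow> ?N `` {k} = {} \<or> ?N `` {k} = ?A k"
      and q': "nat (q + 1) = Suc (\<Sum>k | k \<in> {1..r} \<and> ?N `` {k} \<noteq> {}. card (?A k) - 1)"
      by blast+
    have nonneg: "0 \<le> a k" if "k \<in> {1..r}" "?N `` {k} = {}" for k
    proof -
      have "(k, i) \<notin> ?N" for i using that(2) by blast
      then show ?thesis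
        unfolding sum_e[OF that(1), symmetric]
        by (intro sum_nonneg) (simp add: negative_vars_def not_less)
    qed
    have neg: "a k < - int (l k)" if k: "k \<in> {1..r}" and full: "?N `` {k} = ?A k" for k
    proof -
      \<comment> \<open>All \<open>l k + 1\<close> integer exponents are at most \<open>-1\<close>,
        so \<open>a k \<le> - int (l k) - 1\<close>.\<close>
      have "Poly_Mapping.lookup e (k, i) \<le> -1" if "i \<in> {0..l k}" for i
        using that unfolding full[symmetric] by (auto simp: negative_vars_def)
      then have "(\<Sum>i=0..l k. Poly_Mapping.lookup e (k, i)) \<le> (\<Sum>i=0..l k. -1)"
        by (rule sum_mono)
      then show ?thesis using sum_e[OF k] by simp
    qed
    have "{k \<in> {1..r}. ?N `` {k} \<noteq> {}} = {k \<in> {1..r}. a k < 0}"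
    proof -
      have "?N `` {k} \<noteq> {} \<longleftrightarrow> a k < 0" if "k \<in> {1..r}" for k
        using N[OF that] nonneg[OF that] neg[OF that] by fastforce
      then show ?thesis by blast
    qed
    with q' q have "q = (\<Sum>k | k \<in> {1..r} \<and> a k < 0. int (l k))"
      by (simp add: nat_add_distrib flip: of_nat_sum)
    moreover have "\<forall>k \<in> {1..r}. 0 \<le> a k \<or> a k < - int (l k)"
      using N nonneg neg by blast
    ultimately show False using assms by blast
  qed
  then show "covering_exact TYPE('k) (charts r l) ?N (nat (q + 1))"
    unfolding charts_def
    by (intro covering_exact_PiE negative_vars_subset[OF e]) auto
qed

section \<open>Weyman terms and the bounds on their indices\<close>

lemma trivial_sum_group:
  assumes "\<And>i. i \<in> I \<Longrightarrow> trivial_group (G i)"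
  shows "trivial_group (sum_group I G)"
proof -
  have G: "\<And>i. i \<in> I \<Longrightarrow> group (G i)" "\<And>i. i \<in> I \<Longrightarrow> carrier (G i) = {\<one>\<^bsub>G i\<^esub>}"
    using assms by (auto simp: trivial_group_def)
  have eq: "x = y" if "x \<in> carrier (sum_group I G)" "y \<in> carrier (sum_group I G)" for x y
  proof (rule PiE_ext)
    show "x \<in> (\<Pi>\<^sub>E i\<in>I. carrier (G i))" "y \<in> (\<Pi>\<^sub>E i\<in>I. carrier (G i))"
      using that by (simp_all add: carrier_sum_group[OF G(1)])
    then show "x i = y i" if "i \<in> I" for i
      using G(2)[OF that] that by (metis PiE_mem singletonD)
  qed
  interpret S: group "sum_group I G" by (rule sum_group) (rule G(1))
  show ?thesis
    unfolding S.trivial_group_subset using eq S.one_closed by blast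
qed

text \<open>\<open>J\<close> collects the factors that contribute their top cohomology.\<close>

lemma weyman_index_bounds:
  fixes \<pi> :: "nat \<Rightarrow> nat" and l :: "nat \<Rightarrow> nat" and p :: int
  assumes "finite I" and inj: "inj_on \<pi> I" and "J \<subseteq> I"
    and pos: "\<And>k. k \<in> I \<Longrightarrow> l k > 0" and p: "0 \<le> p" "p \<le> (\<Sum>k\<in>I. int (l k)) + 1"
    and J: "\<And>k. k \<in> J \<Longrightarrow> (\<Sum>j | j \<in> I \<and> \<pi> j \<ge> \<pi> k. int (l j)) \<le> p"
    and not_J: "\<And>k. k \<in> I - J \<Longrightarrow> p \<le> 1 + (\<Sum>j | j \<in> I \<and> \<pi> j > \<pi> k. int (l j))"
  shows "p - (\<Sum>k\<in>J. int (l k)) \<in> {0, 1}"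
proof -
  have finJ: "finite J" using assms(1,3) finite_subset by blast
  \<comment> \<open>Otherwise the two hypotheses squeeze \<open>p\<close> between bounds that are
    incompatible: the sum for \<open>k\<close> exceeds the strict sum for \<open>j\<close> by at
    least \<open>l k + l j\<close>, hence by at least \<open>2\<close>.\<close>
  have upper: "j \<in> J" if "k \<in> J" "j \<in> I" "\<pi> j \<ge> \<pi> k" for j k
  proof (rule ccontr)
    assume "j \<notin> J"
    with that have jk: "\<pi> k < \<pi> j" and j: "j \<in> I - J" and k: "k \<in> I"
      using inj assms(3) by (auto simp: inj_on_def order.strict_iff_order)
    have "k \<notin> insert j {i \<in> I. \<pi> i > \<pi> j}" using jk by auto
    then have "(\<Sum>i | i \<in> I \<and> \<pi> i > \<pi> j. int (l i)) + int (l k) + int (l j)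
        = (\<Sum>i\<in>insert k (insert j {i \<in> I. \<pi> i > \<pi> j}). int (l i))"
      using assms(1) by simp
    also have "\<dots> \<le> (\<Sum>i | i \<in> I \<and> \<pi> i \<ge> \<pi> k. int (l i))"
      using jk j k assms(1) by (intro sum_mono2) auto
    also have "\<dots> \<le> p" using J that by blast
    also have "p \<le> 1 + (\<Sum>i | i \<in> I \<and> \<pi> i > \<pi> j. int (l i))" by (rule not_J[OF j])
    finally show False using pos[OF k] pos[of j] j by simp
  qed
  have "(\<Sum>k\<in>J. int (l k)) \<le> p"
  proof (cases "J = {}")
    case False
    \<comment> \<open>At the \<open>\<pi>\<close>-least element of \<open>J\<close>, the sum in
      hypothesis \<open>J\<close> runs over exactly \<open>J\<close>.\<close>
    then obtain k where k: "k \<in> J" "\<And>j. j \<in> J \<Longrightarrow> \<pi> k \<le> \<pi> j"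
      using finJ arg_min_if_finite(1)[of J \<pi>] arg_min_least[of J _ \<pi>] by blast
    then have "J = {j \<in> I. \<pi> j \<ge> \<pi> k}" using upper assms(3) by blast
    then show ?thesis using J[OF k(1)] by simp
  qed (use p in simp)
  moreover have "p \<le> 1 + (\<Sum>k\<in>J. int (l k))"
  proof (cases "J = I")
    case False
    then have "I - J \<noteq> {}" using assms(3) by blast
    then have "Max (\<pi> ` (I - J)) \<in> \<pi> ` (I - J)"
      using assms(1) by (intro Max_in) auto
    \<comment> \<open>At the \<open>\<pi>\<close>-greatest element outside \<open>J\<close>, the
      strict sum in \<open>not_J\<close> runs over exactly \<open>J\<close>.\<close>
    then obtain k where k: "k \<in> I - J" "Max (\<pi> ` (I - J)) = \<pi> k" by blast
    have max: "\<pi> j \<le> \<pi> k" if "j \<in> I - J" for j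
      using that assms(1) unfolding k(2)[symmetric] by simp
    have "\<pi> k < \<pi> j" if "j \<in> J" for j
      using upper[OF that, of k] k(1) by fastforce
    then have "{j \<in> I. \<pi> j > \<pi> k} = J"
      using max assms(3) by fastforce
    then show ?thesis using not_J[OF k(1)] by simp
  qed (use p in simp)
  ultimately show ?thesis by auto
qed

theorem theorem4p1:
  fixes r :: nat and l d :: "nat \<Rightarrow> nat" and \<pi> :: "nat \<Rightarrow> nat"
  assumes "r \<ge> 1"
    and "\<And>k. k \<in> {1..r} \<Longrightarrow> l k > 0"
    and "\<And>k. k \<in> {1..r} \<Longrightarrow> d k > 0"
    and "\<And>k. k \<in> {1..r} \<Longrightarrow> 0 \<le> defect l d k \<and> defect l d k \<le> 2"
    and "\<pi> permutes {1..r}"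
  shows "determinantal TYPE('k :: {alg_closed_field, field_char_0}) r l d
           (\<lambda>k. (1 - defect l d k + (\<Sum>j | j \<in> {1..r} \<and> \<pi> j \<ge> \<pi> k. int (l j))) * int (d k)
                 - int (l k))"
proof -
  let ?s = "\<lambda>k. \<Sum>j | j \<in> {1..r} \<and> \<pi> j \<ge> \<pi> k. int (l j)"
  let ?t = "\<lambda>k. \<Sum>j | j \<in> {1..r} \<and> \<pi> j > \<pi> k. int (l j)"
  let ?m = "\<lambda>k. (1 - defect l d k + ?s k) * int (d k) - int (l k)"
  have inj: "inj_on \<pi> {1..r}" using assms(5) permutes_inj_on by blast
  have s_eq: "?s k = int (l k) + ?t k" if "k \<in> {1..r}" for k
  proof -
    have "\<pi> j \<ge> \<pi> k \<longleftrightarrow> j = k \<or> \<pi> j > \<pi> k" if "j \<in> {1..r}" for j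
      using inj_on_eq_iff[OF inj that \<open>k \<in> {1..r}\<close>] by auto
    then have "{j. j \<in> {1..r} \<and> \<pi> j \<ge> \<pi> k} = insert k {j. j \<in> {1..r} \<and> \<pi> j > \<pi> k}"
      using that by blast
    then show ?thesis by simp
  qed
  have vanish: "trivial_group (cohomology r l (int p - \<nu>) (\<lambda>k. ?m k - int p * int (d k))
      :: 'k cochain set monoid)"
    if p: "p \<le> (\<Sum>k=1..r. l k) + 1" and \<nu>: "\<nu> \<notin> {0, 1}" for p \<nu>
  proof (rule cohomology_vanishing, rule notI, elim conjE)
    let ?a = "\<lambda>k. ?m k - int p * int (d k)"
    let ?J = "{k \<in> {1..r}. ?a k < 0}"
    have a_eq: "?a k = (1 - defect l d k + ?s k - int p) * int (d k) - int (l k)" for k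
      by (simp add: algebra_simps)
    assume a: "\<forall>k \<in> {1..r}. 0 \<le> ?a k \<or> ?a k < - int (l k)"
      and q: "int p - \<nu> = (\<Sum>k\<in>?J. int (l k))"
    \<comment> \<open>By \<open>q\<close> this difference is \<open>\<nu>\<close>, so the bound
      contradicts the choice of \<open>\<nu>\<close>.\<close>
    have "int p - (\<Sum>k\<in>?J. int (l k)) \<in> {0, 1}"
    proof (rule weyman_index_bounds[OF _ inj])
      show "int p \<le> (\<Sum>k=1..r. int (l k)) + 1"
        using p by (simp flip: of_nat_sum)
    next
      fix k assume k: "k \<in> ?J"
      then have "(1 - defect l d k + ?s k - int p) * int (d k) < 0"
        using a unfolding a_eq by fastforce
      then have "1 - defect l d k + ?s k - int p < 0"
        by (simp only: mult_less_0_iff) linarith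
      \<comment> \<open>Integrality gives \<open>?s k \<le> int p + defect l d k - 2\<close>, and
        the defect is at most \<open>2\<close>.\<close>
      then show "?s k \<le> int p" using assms(4)[of k] k by auto
    next
      fix k assume k: "k \<in> {1..r} - ?J"
      let ?x = "1 - defect l d k + ?s k - int p"
      have "int (l k) \<le> ?x * int (d k)" using k unfolding a_eq by auto
      then have "real (l k) \<le> of_int ?x * real (d k)"
        by (metis of_int_le_iff of_int_mult of_int_of_nat_eq)
      then have "real (l k) / real (d k) \<le> of_int ?x"
        using assms(3)[of k] k by (simp add: pos_divide_le_eq)
      \<comment> \<open>The ceiling is \<open>int (l k) - defect l d k\<close>, so the defect
        cancels against the one in \<open>?x\<close>.\<close>
      then have "\<lceil>real (l k) / real (d k)\<rceil> \<le> ?x" by (rule ceiling_le)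
      then have "int (l k) - defect l d k \<le> ?x" by (simp add: defect_def)
      then show "int p \<le> 1 + ?t k" using s_eq[of k] k by simp
    qed (use assms in auto)
    with q \<nu> show False by simp
  qed
  have "trivial_group (weyman_term r l d ?m \<nu> :: (nat \<times> nat \<Rightarrow> 'k cochain set) monoid)"
    if \<nu>: "\<nu> \<notin> {0, 1}" for \<nu>
    unfolding weyman_term_def Let_def
  proof (rule trivial_sum_group)
    fix i assume "i \<in> (SIGMA p:{0..(\<Sum>k=1..r. l k) + 1}. {..<(\<Sum>k=1..r. l k) + 1 choose p})"
    then obtain p c where "i = (p, c)" "p \<le> (\<Sum>k=1..r. l k) + 1" by auto
    then show "trivial_group ((\<lambda>(p, c). cohomology r l (int p - \<nu>) (\<lambda>k. ?m k - int p * int (d k))) i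
        :: 'k cochain set monoid)"
      using vanish[OF _ \<nu>] by simp
  qed
  then show ?thesis unfolding determinantal_def by blast
qed

end
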